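(* Let $T=\{0,1,2\}$ be linearly ordered by $0<1<2$. Then $\mathbf{Z}$, regarded as the constant diagram, is not cancellable in the category $\mathcal{D}_T(\mathbf{Ab})$ of diagrams of abelian groups based on $T$; that is, there exist objects $B$ and $C$ of $\mathcal{D}_T(\mathbf{Ab})$ such that $B\oplus\mathbf{Z}$ is isomorphic to $C\oplus\mathbf{Z}$ but $B$ is not isomorphic to $C$.
   Context: For a finite poset $T$ with a least element, $\mathcal{D}_T(\mathbf{Ab})$ is the abelian category of diagrams of abelian groups based on $T$: an object is a functor from $T$ (viewed as a category, with one arrow $i\to j$ whenever $i\le j$) to the category $\mathbf{Ab}$ of abelian groups, and morphisms are natural transformations. Direct sums are computed node by node. An abelian group $G$ is identified with the constant diagram having $G$ at every node and identity maps between the nodes; in particular $\mathbf{Z}$ denotes the constant diagram of the additive group of integers. An object $G$ of an additive category is cancellable if whenever $B\oplus G$ is isomorphic to $C\oplus G$, then $B$ is isomorphic to $C$. *)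

theory Defs
  imports "HOL-Algebra.Elementary_Groups"
begin

(* A functor from a poset, given by a carrier set of indices, to abelian groups. Values of
   node and arr outside the index set (and of an arrow outside its source) carry no meaning.
   Abelian groups are written with the multiplicative record syntax of HOL-Algebra. *)

record ('i, 'a) diagram =
  node :: "'i \<Rightarrow> 'a monoid"
  arr :: "'i \<Rightarrow> 'i \<Rightarrow> 'a \<Rightarrow> 'a"

definition is_diagram :: "'i::order set \<Rightarrow> ('i, 'a) diagram \<Rightarrow> bool" where
  "is_diagram T D \<longleftrightarrow>
     (\<forall>i\<in>T. comm_group (node D i)) \<and>
     (\<forall>i\<in>T. \<forall>j\<in>T. i \<le> j \<longrightarrow> arr D i j \<in> hom (node D i) (node D j)) \<and>
     (\<forall>i\<in>T. \<forall>x\<in>carrier (node D i). arr D i i x = x) \<and>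
     (\<forall>i\<in>T. \<forall>j\<in>T. \<forall>k\<in>T. i \<le> j \<longrightarrow> j \<le> k \<longrightarrow>
        (\<forall>x\<in>carrier (node D i). arr D j k (arr D i j x) = arr D i k x))"

definition diagram_hom ::
  "'i::order set \<Rightarrow> ('i, 'a) diagram \<Rightarrow> ('i, 'b) diagram \<Rightarrow> ('i \<Rightarrow> 'a \<Rightarrow> 'b) set" where
  "diagram_hom T D E =
     {f. (\<forall>i\<in>T. f i \<in> hom (node D i) (node E i)) \<and>
         (\<forall>i\<in>T. \<forall>j\<in>T. i \<le> j \<longrightarrow>
            (\<forall>x\<in>carrier (node D i). f j (arr D i j x) = arr E i j (f i x)))}"

definition diagram_isomorphic ::
  "'i::order set \<Rightarrow> ('i, 'a) diagram \<Rightarrow> ('i, 'b) diagram \<Rightarrow> bool" where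
  "diagram_isomorphic T D E \<longleftrightarrow>
     (\<exists>f\<in>diagram_hom T D E. \<exists>g\<in>diagram_hom T E D.
        \<forall>i\<in>T. (\<forall>x\<in>carrier (node D i). g i (f i x) = x) \<and>
               (\<forall>y\<in>carrier (node E i). f i (g i y) = y))"

definition diagram_sum ::
  "('i, 'a) diagram \<Rightarrow> ('i, 'b) diagram \<Rightarrow> ('i, 'a \<times> 'b) diagram" where
  "diagram_sum D E =
     \<lparr>node = (\<lambda>i. node D i \<times>\<times> node E i),
      arr = (\<lambda>i j. map_prod (arr D i j) (arr E i j))\<rparr>"

definition const_diagram :: "'a monoid \<Rightarrow> ('i, 'a) diagram" where
  "const_diagram G = \<lparr>node = (\<lambda>_. G), arr = (\<lambda>_ _ x. x)\<rparr>"

(* HOL cannot quantify over all groups of all types inside a formula, so the type 'b plays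
   the role of a universe: B and C range over the diagrams of groups whose elements lie in 'b.
   G need not live in the same universe. TYPE('b) should be infinite: the larger 'b is, the more
   diagrams are covered, and a failure of cancellability over nat is one by countable groups. *)

definition cancellable :: "'b itself \<Rightarrow> 'i::order set \<Rightarrow> ('i, 'g) diagram \<Rightarrow> bool" where
  "cancellable _ T G \<longleftrightarrow>
     (\<forall>(B :: ('i, 'b) diagram) (C :: ('i, 'b) diagram). is_diagram T B \<longrightarrow> is_diagram T C \<longrightarrow>
        diagram_isomorphic T (diagram_sum B G) (diagram_sum C G) \<longrightarrow>
        diagram_isomorphic T B C)"

lemma is_diagram_const: "comm_group G \<Longrightarrow> is_diagram T (const_diagram G)"
  by (auto simp: is_diagram_def const_diagram_def hom_def)

lemma is_diagram_sum:
  assumes "is_diagram T D" "is_diagram T E"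
  shows "is_diagram T (diagram_sum D E)"
proof -
  have "comm_group (node D i \<times>\<times> node E i)" if "i \<in> T" for i
  proof -
    interpret D: comm_group "node D i" using assms that by (simp add: is_diagram_def)
    interpret E: comm_group "node E i" using assms that by (simp add: is_diagram_def)
    show ?thesis
      by (intro group.group_comm_groupI DirProd_group D.is_group E.is_group)
         (auto simp: D.m_comm E.m_comm)
  qed
  with assms show ?thesis
    unfolding is_diagram_def diagram_sum_def by (auto simp: hom_def Pi_iff)
qed

end

theory Submission
  imports Defs "HOL-Library.Countable"
begin

text \<open>
  For integers \<open>n \<noteq> 0\<close> and \<open>u\<close> let \<open>B u\<close> be the diagram
  \<open>\<int> \<rightarrow> \<int>\<^sup>2 \<rightarrow> \<int>\<close> with maps \<open>x \<mapsto> (x, 0)\<close> and \<open>(x, y) \<mapsto> n x + u y\<close>. It is an extension of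
  the diagram \<open>S = (0 \<rightarrow> \<int> \<rightarrow> 0)\<close> by \<open>L = (n\<int> \<rightarrow> n\<int> \<rightarrow> \<int>)\<close>, a subdiagram of the constant diagram
  \<open>\<int>\<close>, and \<open>u\<close> modulo \<open>n\<close> is its class in \<open>Ext(S, L) = \<int>/n\<close>.

  Every isomorphism respects the extension and the only automorphisms of \<open>S\<close> and of \<open>L\<close> are \<open>\<plusminus>1\<close>, so
  \<open>B u\<close> and \<open>B v\<close> are isomorphic only if \<open>u\<close> and \<open>v\<close> agree up to sign modulo \<open>n\<close>
  (\<open>twisted_isomorphicD\<close>).

  After adding the constant diagram \<open>\<int>\<close> there is more room: \<open>Ext(S, \<int>) = 0\<close>, so the class of the
  extension of \<open>S\<close> by \<open>L \<oplus> \<int>\<close> is still \<open>u\<close>, while an automorphism of \<open>L \<oplus> \<int>\<close> is an integer matrix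
  of determinant \<open>\<plusminus>1\<close> in which the composite of the two off-diagonal entries is only required to be
  a multiple of \<open>n\<close>. Its entry \<open>L \<rightarrow> L\<close> may therefore be any unit \<open>v\<close> modulo \<open>n\<close>, and so
  \<open>B 1 \<oplus> \<int>\<close> and \<open>B v \<oplus> \<int>\<close> are isomorphic (\<open>twisted_stably_isomorphic\<close>). With
  \<open>n = 5\<close> and \<open>v = 2\<close> cancellation fails.

  These diagrams consist of countable groups, so an injection carries them into any infinite
  type (\<open>not_cancellableI\<close>).
\<close>

section \<open>Isomorphisms of diagrams\<close>

lemma diagram_isomorphic_sym:
  "diagram_isomorphic T D E \<Longrightarrow> diagram_isomorphic T E D"
  unfolding diagram_isomorphic_def by blast

lemma diagram_hom_comp:
  assumes "f \<in> diagram_hom T D E" "g \<in> diagram_hom T E F"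
  shows "(\<lambda>i x. g i (f i x)) \<in> diagram_hom T D F"
  using assms by (auto simp: diagram_hom_def hom_def Pi_iff)

lemma diagram_hom_closed:
  "f \<in> diagram_hom T D E \<Longrightarrow> i \<in> T \<Longrightarrow> x \<in> carrier (node D i) \<Longrightarrow> f i x \<in> carrier (node E i)"
  by (auto simp: diagram_hom_def hom_def)

lemma diagram_isomorphic_trans:
  assumes "diagram_isomorphic T D E" "diagram_isomorphic T E F"
  shows "diagram_isomorphic T D F"
proof -
  obtain f g where fg: "f \<in> diagram_hom T D E" "g \<in> diagram_hom T E D"
    "\<And>i x. i \<in> T \<Longrightarrow> x \<in> carrier (node D i) \<Longrightarrow> g i (f i x) = x"
    "\<And>i y. i \<in> T \<Longrightarrow> y \<in> carrier (node E i) \<Longrightarrow> f i (g i y) = y"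
    using assms(1) unfolding diagram_isomorphic_def by blast
  obtain h k where hk: "h \<in> diagram_hom T E F" "k \<in> diagram_hom T F E"
    "\<And>i x. i \<in> T \<Longrightarrow> x \<in> carrier (node E i) \<Longrightarrow> k i (h i x) = x"
    "\<And>i y. i \<in> T \<Longrightarrow> y \<in> carrier (node F i) \<Longrightarrow> h i (k i y) = y"
    using assms(2) unfolding diagram_isomorphic_def by blast
  show ?thesis
    unfolding diagram_isomorphic_def
    by (rule bexI[OF _ diagram_hom_comp[OF fg(1) hk(1)]],
        rule bexI[OF _ diagram_hom_comp[OF hk(2) fg(2)]])
      (simp add: fg hk diagram_hom_closed[OF fg(1)] diagram_hom_closed[OF hk(2)])
qed

lemma diagram_isomorphic_sum_left:
  assumes "diagram_isomorphic T D E"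
  shows "diagram_isomorphic T (diagram_sum D G) (diagram_sum E G)"
proof -
  obtain f g where fg: "f \<in> diagram_hom T D E" "g \<in> diagram_hom T E D"
    "\<And>i x. i \<in> T \<Longrightarrow> x \<in> carrier (node D i) \<Longrightarrow> g i (f i x) = x"
    "\<And>i y. i \<in> T \<Longrightarrow> y \<in> carrier (node E i) \<Longrightarrow> f i (g i y) = y"
    using assms unfolding diagram_isomorphic_def by blast
  have lift: "(\<lambda>i. map_prod (h i) id) \<in> diagram_hom T (diagram_sum X G) (diagram_sum Y G)"
    if "h \<in> diagram_hom T X Y" for h and X :: "('a, 'x) diagram" and Y :: "('a, 'y) diagram"
    using that by (auto simp: diagram_hom_def diagram_sum_def hom_def Pi_iff)
  show ?thesis
    unfolding diagram_isomorphic_def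
    by (rule bexI[OF _ lift[OF fg(1)]], rule bexI[OF _ lift[OF fg(2)]])
      (auto simp: diagram_sum_def fg)
qed

section \<open>Transport of diagrams along an injection\<close>

definition transport_group :: "('a \<Rightarrow> 'b) \<Rightarrow> 'a monoid \<Rightarrow> 'b monoid" where
  "transport_group h G =
     \<lparr>carrier = h ` carrier G,
      mult = (\<lambda>x y. h (inv_into UNIV h x \<otimes>\<^bsub>G\<^esub> inv_into UNIV h y)),
      one = h \<one>\<^bsub>G\<^esub>\<rparr>"

definition transport_diagram :: "('a \<Rightarrow> 'b) \<Rightarrow> ('i, 'a) diagram \<Rightarrow> ('i, 'b) diagram" where
  "transport_diagram h D =
     \<lparr>node = (\<lambda>i. transport_group h (node D i)),
      arr = (\<lambda>i j x. h (arr D i j (inv_into UNIV h x)))\<rparr>"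

lemma comm_group_transport:
  assumes "inj h" "comm_group G"
  shows "comm_group (transport_group h G)"
proof -
  interpret G: comm_group G by fact
  show ?thesis
  proof (rule comm_groupI)
    fix x assume "x \<in> carrier (transport_group h G)"
    then obtain a where a: "a \<in> carrier G" "x = h a"
      by (auto simp: transport_group_def)
    then obtain b where "b \<in> carrier G" "b \<otimes>\<^bsub>G\<^esub> a = \<one>\<^bsub>G\<^esub>"
      using G.l_inv_ex by blast
    then show "\<exists>y\<in>carrier (transport_group h G).
        y \<otimes>\<^bsub>transport_group h G\<^esub> x = \<one>\<^bsub>transport_group h G\<^esub>"
      using assms(1) a by (intro bexI[of _ "h b"]) (auto simp: transport_group_def)
  qed (use assms(1) in \<open>auto simp: transport_group_def G.m_ac\<close>)
qed

lemma is_diagram_transport: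
  assumes "inj h" "is_diagram T D"
  shows "is_diagram T (transport_diagram h D)"
  using assms comm_group_transport[OF assms(1)]
  by (auto simp: is_diagram_def transport_diagram_def transport_group_def hom_def Pi_iff)

lemma transport_isomorphic:
  assumes "inj h" "is_diagram T D"
  shows "diagram_isomorphic T D (transport_diagram h D)"
proof -
  have "(\<lambda>_. h) \<in> diagram_hom T D (transport_diagram h D)"
    "(\<lambda>_. inv_into UNIV h) \<in> diagram_hom T (transport_diagram h D) D"
    using assms
    by (auto simp: diagram_hom_def transport_diagram_def transport_group_def hom_def is_diagram_def)
  then show ?thesis
    unfolding diagram_isomorphic_def
    by (intro bexI[of _ "\<lambda>_. h"] bexI[of _ "\<lambda>_. inv_into UNIV h"])
      (use assms(1) in \<open>auto simp: transport_diagram_def transport_group_def\<close>)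
qed

text \<open>Cancellability only concerns diagrams up to isomorphism, so a counterexample may be
  presented in any type that embeds into the universe.\<close>

lemma not_cancellableI:
  fixes h :: "'a \<Rightarrow> 'b" and B C :: "('i::order, 'a) diagram"
  assumes h: "inj h" and B: "is_diagram T B" and C: "is_diagram T C"
    and stable: "diagram_isomorphic T (diagram_sum B G) (diagram_sum C G)"
    and not_iso: "\<not> diagram_isomorphic T B C"
  shows "\<not> cancellable TYPE('b) T G"
proof
  assume canc: "cancellable TYPE('b) T G"
  note iso_B = transport_isomorphic[OF h B] and iso_C = transport_isomorphic[OF h C]
  have "diagram_isomorphic T (diagram_sum (transport_diagram h B) G)
          (diagram_sum (transport_diagram h C) G)"
    using stable iso_B iso_C
    by (meson diagram_isomorphic_sum_left diagram_isomorphic_sym diagram_isomorphic_trans)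
  then have "diagram_isomorphic T (transport_diagram h B) (transport_diagram h C)"
    using canc is_diagram_transport[OF h B] is_diagram_transport[OF h C]
    unfolding cancellable_def by blast
  then show False
    using not_iso iso_B iso_C by (meson diagram_isomorphic_sym diagram_isomorphic_trans)
qed

section \<open>The twisted diagrams\<close>

text \<open>All three nodes have to live in one type, so the nodes \<open>0\<close> and \<open>2\<close> are \<open>\<int> \<times> 0\<close>. At node
  \<open>0\<close> therefore \<open>y = 0\<close>, and the arrow to node \<open>2\<close> is multiplication by \<open>n\<close>.\<close>

definition twisted :: "int \<Rightarrow> int \<Rightarrow> (nat, int \<times> int) diagram" where
  "twisted n u =
     \<lparr>node = (\<lambda>i. integer_group \<times>\<times> (if i = 1 then integer_group else singleton_group 0)),
      arr = (\<lambda>i j (x, y). if i \<noteq> 2 \<and> j = 2 then (n * x + u * y, 0) else (x, y))\<rparr>"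

lemma is_diagram_twisted: "is_diagram {0, 1, 2} (twisted n u)"
proof -
  have "comm_group (G \<times>\<times> H)" if "comm_group G" "comm_group H" for G H :: "int monoid"
  proof -
    interpret G: comm_group G by fact
    interpret H: comm_group H by fact
    show ?thesis
      by (intro group.group_comm_groupI DirProd_group G.is_group H.is_group)
        (auto simp: G.m_comm H.m_comm)
  qed
  then have "comm_group (node (twisted n u) i)" for i
    by (simp add: twisted_def abelian_integer_group)
  then show ?thesis
    by (auto simp: is_diagram_def twisted_def hom_def singleton_group_def algebra_simps)
qed

lemma additive_int_eq_mult:
  fixes h :: "int \<Rightarrow> int"
  assumes "\<And>x y. h (x + y) = h x + h y"
  shows "h x = x * h 1"
proof (induction x rule: int_induct[of _ 0])
  case base
  show ?case using assms[of 0 0] by simp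
next
  case (step1 i)
  then show ?case by (simp add: assms algebra_simps)
next
  case (step2 i)
  then show ?case using assms[of "i - 1" 1] by (simp add: algebra_simps)
qed

text \<open>A homomorphism preserves the image of node \<open>0\<close> in node \<open>1\<close>, so on the quotient \<open>\<int>\<close> of node
  \<open>1\<close> by this image it is multiplication by some \<open>e\<close>. On node \<open>2\<close> it is multiplication by some
  \<open>a\<close>. Naturality of the arrow from \<open>1\<close> to \<open>2\<close> at \<open>(0, 1)\<close> links \<open>a\<close> and \<open>e\<close>.\<close>

lemma twisted_homD:
  assumes f: "f \<in> diagram_hom {0, 1, 2} (twisted n u) (twisted n v)"
  shows "\<exists>a e k. (\<forall>w. f 2 (w, 0) = (a * w, 0)) \<and> (\<forall>x y. snd (f 1 (x, y)) = e * y) \<and>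
    a * u = n * k + v * e"
proof -
  let ?Z = "integer_group" and ?O = "singleton_group (0::int)"
  have h0: "f 0 \<in> hom (?Z \<times>\<times> ?O) (?Z \<times>\<times> ?O)"
    and h1: "f 1 \<in> hom (?Z \<times>\<times> ?Z) (?Z \<times>\<times> ?Z)"
    and h2: "f 2 \<in> hom (?Z \<times>\<times> ?O) (?Z \<times>\<times> ?O)"
    using f by (simp_all add: diagram_hom_def twisted_def)
  have nat01: "f 1 (x, 0) = f 0 (x, 0)" for x
    using f by (simp add: diagram_hom_def twisted_def split_beta)
  have nat12: "f 2 (n * x + u * y, 0) = (n * fst (f 1 (x, y)) + v * snd (f 1 (x, y)), 0)" for x y
    using f by (simp add: diagram_hom_def twisted_def split_beta)
  have snd0: "snd (f 0 (x, 0)) = 0" and snd2: "snd (f 2 (x, 0)) = 0" for x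
    using hom_in_carrier[OF h0, of "(x, 0)"] hom_in_carrier[OF h2, of "(x, 0)"]
    by (simp_all add: mem_Times_iff)
  have add2: "fst (f 2 (x + y, 0)) = fst (f 2 (x, 0)) + fst (f 2 (y, 0))" for x y
    using hom_mult[OF h2, of "(x, 0)" "(y, 0)"]
    by (simp add: mult_DirProd' singleton_group_def)
  have add1: "snd (f 1 (x + x', y + y')) = snd (f 1 (x, y)) + snd (f 1 (x', y'))" for x x' y y'
    using hom_mult[OF h1, of "(x, y)" "(x', y')"] by (simp add: mult_DirProd')
  define a where "a = fst (f 2 (1, 0))"
  define e where "e = snd (f 1 (0, 1))"
  have "fst (f 2 (w, 0)) = w * a" for w
    unfolding a_def by (rule additive_int_eq_mult[OF add2])
  then have two: "f 2 (w, 0) = (a * w, 0)" for w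
    by (simp add: prod_eq_iff snd2)
  have one: "snd (f 1 (x, y)) = e * y" for x y
  proof -
    have "snd (f 1 (0, y)) = y * e"
      unfolding e_def by (rule additive_int_eq_mult) (use add1[of 0 0] in simp)
    moreover have "snd (f 1 (x, y)) = snd (f 1 (x, 0)) + snd (f 1 (0, y))"
      using add1[of x 0 0 y] by simp
    ultimately show ?thesis using nat01[of x] snd0[of x] by simp
  qed
  have "a * u = n * fst (f 1 (0, 1)) + v * e"
    using nat12[of 0 1] by (simp add: two e_def)
  with two one show ?thesis by blast
qed

lemma twisted_isomorphicD:
  assumes "diagram_isomorphic {0, 1, 2} (twisted n u) (twisted n v)"
  shows "n dvd u - v \<or> n dvd u + v"
proof -
  obtain f g where f: "f \<in> diagram_hom {0, 1, 2} (twisted n u) (twisted n v)"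
    and g: "g \<in> diagram_hom {0, 1, 2} (twisted n v) (twisted n u)"
    and gf: "\<forall>i\<in>{0, 1, 2}. \<forall>x\<in>carrier (node (twisted n u) i). g i (f i x) = x"
    using assms unfolding diagram_isomorphic_def by blast
  obtain a e k where f2: "\<And>w. f 2 (w, 0) = (a * w, 0)" and f1: "\<And>x y. snd (f 1 (x, y)) = e * y"
    and link: "a * u = n * k + v * e"
    using twisted_homD[OF f] by blast
  obtain a' e' where g2: "\<And>w. g 2 (w, 0) = (a' * w, 0)" and g1: "\<And>x y. snd (g 1 (x, y)) = e' * y"
    using twisted_homD[OF g] by blast
  have "g 2 (f 2 (1, 0)) = (1, 0)" and gf1: "g 1 (f 1 (0, 1)) = (0, 1)"
    using gf by (auto simp: twisted_def)
  then have "a' * a = 1"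
    by (simp add: f2 g2)
  moreover have "e' * e = 1"
    using g1[of "fst (f 1 (0, 1))" "snd (f 1 (0, 1))"] f1[of 0 1]
    unfolding prod.collapse gf1 by simp
  ultimately have "a dvd 1" "e dvd 1"
    using dvd_triv_right[of a a'] dvd_triv_right[of e e'] by simp_all
  then have "a = 1 \<or> a = -1" "e = 1 \<or> e = -1"
    by auto
  moreover have "n dvd a * a * u - a * e * v"
  proof -
    have "a * a * u - a * e * v = n * (a * k)"
      using arg_cong[OF link, of "\<lambda>t. a * t"] by (simp add: algebra_simps)
    then show ?thesis by simp
  qed
  ultimately show ?thesis
    by (elim disjE) simp_all
qed

text \<open>The automorphism of \<open>L \<oplus> \<int>\<close> is the matrix with rows \<open>(v, b)\<close> and \<open>(n, d)\<close> on nodes \<open>0\<close> and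
  \<open>1\<close>. Node \<open>2\<close> of \<open>L\<close> contains the others as multiples of \<open>n\<close>, so conjugation with the
  diagonal matrix \<open>(n, 1)\<close> turns it into the rows \<open>(v, n b)\<close> and \<open>(1, d)\<close> there. The generator
  \<open>(0, 1)\<close> of the copy of \<open>S\<close> at node \<open>1\<close> maps to \<open>1\<close> at node \<open>2\<close>, which the last matrix
  sends to \<open>(v, 1)\<close>; this is why its image has \<open>\<int>\<close>-component \<open>1\<close>.\<close>

lemma twisted_stably_isomorphic:
  assumes det: "v * d - n * b = 1"
  shows "diagram_isomorphic {0, 1, 2} (diagram_sum (twisted n 1) (const_diagram integer_group))
           (diagram_sum (twisted n v) (const_diagram integer_group))"
proof -
  define f :: "nat \<Rightarrow> (int \<times> int) \<times> int \<Rightarrow> (int \<times> int) \<times> int" where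
    "f = (\<lambda>i ((x, y), z). if i = 2 then ((v * x + n * b * z, y), x + d * z)
                          else ((v * x + b * z, y), n * x + y + d * z))"
  define g :: "nat \<Rightarrow> (int \<times> int) \<times> int \<Rightarrow> (int \<times> int) \<times> int" where
    "g = (\<lambda>i ((x, y), z). if i = 2 then ((d * x - n * b * z, y), v * z - x)
                          else ((d * x - b * (z - y), y), v * (z - y) - n * x))"
  have cancel: "v * (d * x) = x + n * (b * x)" "d * (v * x) = x + n * (b * x)"
    "x * (d * v) = x + n * (b * x)" for x
  proof -
    have "v * d * x = (1 + n * b) * x" using det by simp
    then show "v * (d * x) = x + n * (b * x)" "d * (v * x) = x + n * (b * x)"
      "x * (d * v) = x + n * (b * x)"
      by (simp_all add: algebra_simps)
  qed
  have "f \<in> diagram_hom {0, 1, 2} (diagram_sum (twisted n 1) (const_diagram integer_group))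
              (diagram_sum (twisted n v) (const_diagram integer_group))"
    by (auto simp: diagram_hom_def diagram_sum_def const_diagram_def twisted_def hom_def
        singleton_group_def f_def algebra_simps)
  moreover have "g \<in> diagram_hom {0, 1, 2}
      (diagram_sum (twisted n v) (const_diagram integer_group))
      (diagram_sum (twisted n 1) (const_diagram integer_group))"
    by (auto simp: diagram_hom_def diagram_sum_def const_diagram_def twisted_def hom_def
        singleton_group_def g_def algebra_simps cancel)
  moreover have "g i (f i p) = p" "f i (g i p) = p" for i p
    by (cases p; cases "fst p"; simp add: f_def g_def algebra_simps cancel)+
  ultimately show ?thesis
    unfolding diagram_isomorphic_def by blast
qed

section \<open>Failure of cancellation\<close>

theorem mainTheorem1:
  assumes "infinite (UNIV :: 'b set)"
  shows "\<not> cancellable TYPE('b) {0, 1, 2 :: nat} (const_diagram integer_group)"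
proof -
  obtain s :: "nat \<Rightarrow> 'b" where "inj s"
    using infinite_countable_subset[OF assms] by blast
  then have "inj (s \<circ> (to_nat :: int \<times> int \<Rightarrow> nat))"
    by (intro inj_compose inj_to_nat)
  then show ?thesis
  proof (rule not_cancellableI)
    show "diagram_isomorphic {0, 1, 2}
        (diagram_sum (twisted 5 1) (const_diagram integer_group))
        (diagram_sum (twisted 5 2) (const_diagram integer_group))"
      by (rule twisted_stably_isomorphic[of 2 3 5 1]) simp
    show "\<not> diagram_isomorphic {0, 1, 2} (twisted 5 1) (twisted 5 2)"
      using twisted_isomorphicD[of 5 1 2] by auto
  qed (rule is_diagram_twisted)+
qed

end
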